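(* Let $I\subset\mathbb{R}$ be an interval and let $\gamma:I\to\mathbb{R}^3$ be a non-degenerate curve with curvature $\kappa$ and torsion $\tau$. (1) Suppose that $\tau(t)\neq0$ for all $t\in I$. Then $\gamma$ is a $(t,n,\overline{t})$-Bertrand type curve if and only if there exists a smooth map $(\lambda,\eta):I\to\mathbb{R}^2$ with $\eta(t)\neq0$ such that $$|\dot\gamma(t)|+\dot\lambda(t)-\eta(t)|\dot\gamma(t)|\kappa(t)=0,\qquad \lambda(t)|\dot\gamma(t)|\kappa(t)+\dot\eta(t)=0$$ for all $t\in I$. (2) Suppose that there exists a point $t\in I$ such that $\tau(t)=0$. Then $\gamma$ is not a $(t,n,\overline{t})$-Bertrand type curve.
   Context: All maps are $C^\infty$. A smooth curve $\gamma:I\to\mathbb{R}^3$ is non-degenerate if it is regular ($\dot\gamma(t)\neq0$ for all $t$) and $\dot\gamma(t)\times\ddot\gamma(t)\neq 0$ for all $t\in I$. For such a curve, the tangent, bi-normal and principal normal vectors are $t=\dot\gamma/|\dot\gamma|$, $b=(\dot\gamma\times\ddot\gamma)/|\dot\gamma\times\ddot\gamma|$, $n=b\times t$, the curvature is $\kappa=|\dot\gamma\times\ddot\gamma|/|\dot\gamma|^3$ and the torsion is $\tau=\det(\dot\gamma,\ddot\gamma,\dddot\gamma)/|\dot\gamma\times\ddot\gamma|^2$ (the letter $t$ also denotes the parameter). For a second non-degenerate curve $\overline\gamma$, barred symbols $\overline t,\overline n,\overline b$ denote its frame vectors. For $v,w,x\in\{t,n,b\}$, non-degenerate curves $\gamma,\overline\gamma:I\to\mathbb{R}^3$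 are $(v,w,\overline x)$-mates if there exists a smooth map $(\lambda,\eta):I\to\mathbb{R}^2$ with $(\lambda,\eta)\not\equiv(0,0)$ such that $\overline\gamma(t)=\gamma(t)+\lambda(t)v(t)+\eta(t)w(t)$ and $v(t)\times w(t)=\pm\overline x(t)$ for all $t\in I$. The curve $\gamma$ is a $(v,w,\overline x)$-Bertrand type curve if there exists another non-degenerate curve $\overline\gamma$ such that $\gamma$ and $\overline\gamma$ are $(v,w,\overline x)$-mates. Here $(\lambda,\eta)\not\equiv(0,0)$ means that $(\lambda,\eta)$ is not identically zero on any non-trivial subinterval of $I$. *)

theory Defs
  imports "HOL-Analysis.Analysis"
begin

(* Intervals may be open, closed, half-open or unbounded, but must have more than one point.
   All derivatives are taken within I, hence are one-sided at end points contained in I. *)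

definition nontrivial_interval :: "real set \<Rightarrow> bool" where
  "nontrivial_interval I \<longleftrightarrow> is_interval I \<and> (\<exists>a\<in>I. \<exists>b\<in>I. a < b)"

primrec nth_deriv :: "real set \<Rightarrow> nat \<Rightarrow> (real \<Rightarrow> 'a::real_normed_vector) \<Rightarrow> real \<Rightarrow> 'a" where
  "nth_deriv I 0 f = f"
| "nth_deriv I (Suc k) f = (\<lambda>s. vector_derivative (nth_deriv I k f) (at s within I))"

definition smooth_on :: "real set \<Rightarrow> (real \<Rightarrow> 'a::real_normed_vector) \<Rightarrow> bool" where
  "smooth_on I f \<longleftrightarrow> (\<forall>k. \<forall>s\<in>I. nth_deriv I k f differentiable (at s within I))"

definition nondegenerate_curve :: "real set \<Rightarrow> (real \<Rightarrow> real^3) \<Rightarrow> bool" where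
  "nondegenerate_curve I \<gamma> \<longleftrightarrow> smooth_on I \<gamma> \<and>
     (\<forall>s\<in>I. nth_deriv I 1 \<gamma> s \<noteq> 0 \<and> cross3 (nth_deriv I 1 \<gamma> s) (nth_deriv I 2 \<gamma> s) \<noteq> 0)"

definition speed :: "real set \<Rightarrow> (real \<Rightarrow> real^3) \<Rightarrow> real \<Rightarrow> real" where
  "speed I \<gamma> s = norm (nth_deriv I 1 \<gamma> s)"

definition tangent :: "real set \<Rightarrow> (real \<Rightarrow> real^3) \<Rightarrow> real \<Rightarrow> real^3" where
  "tangent I \<gamma> s = nth_deriv I 1 \<gamma> s /\<^sub>R norm (nth_deriv I 1 \<gamma> s)"

definition binormal :: "real set \<Rightarrow> (real \<Rightarrow> real^3) \<Rightarrow> real \<Rightarrow> real^3" where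
  "binormal I \<gamma> s =
     cross3 (nth_deriv I 1 \<gamma> s) (nth_deriv I 2 \<gamma> s) /\<^sub>R
       norm (cross3 (nth_deriv I 1 \<gamma> s) (nth_deriv I 2 \<gamma> s))"

definition principal_normal :: "real set \<Rightarrow> (real \<Rightarrow> real^3) \<Rightarrow> real \<Rightarrow> real^3" where
  "principal_normal I \<gamma> s = cross3 (binormal I \<gamma> s) (tangent I \<gamma> s)"

definition curvature :: "real set \<Rightarrow> (real \<Rightarrow> real^3) \<Rightarrow> real \<Rightarrow> real" where
  "curvature I \<gamma> s =
     norm (cross3 (nth_deriv I 1 \<gamma> s) (nth_deriv I 2 \<gamma> s)) / norm (nth_deriv I 1 \<gamma> s) ^ 3"

definition torsion :: "real set \<Rightarrow> (real \<Rightarrow> real^3) \<Rightarrow> real \<Rightarrow> real" where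
  "torsion I \<gamma> s =
     det (vector [nth_deriv I 1 \<gamma> s, nth_deriv I 2 \<gamma> s, nth_deriv I 3 \<gamma> s] :: real^3^3) /
       (norm (cross3 (nth_deriv I 1 \<gamma> s) (nth_deriv I 2 \<gamma> s)))\<^sup>2"

datatype frame_index = Tangent | Normal | Binormal

fun frame :: "real set \<Rightarrow> (real \<Rightarrow> real^3) \<Rightarrow> frame_index \<Rightarrow> real \<Rightarrow> real^3" where
  "frame I \<gamma> Tangent = tangent I \<gamma>"
| "frame I \<gamma> Normal = principal_normal I \<gamma>"
| "frame I \<gamma> Binormal = binormal I \<gamma>"

definition not_identically_zero_on_subintervals :: "real set \<Rightarrow> (real \<Rightarrow> 'a::zero) \<Rightarrow> bool" where
  "not_identically_zero_on_subintervals I f \<longleftrightarrow>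
     (\<forall>J. J \<subseteq> I \<and> nontrivial_interval J \<longrightarrow> (\<exists>s\<in>J. f s \<noteq> 0))"

(* mates I v w x g h: g and h are (v, w, x-bar)-mates.  The frame vectors v and w are those
   of g, whereas x is taken from the frame of h; the sign may a priori depend on the parameter. *)

definition mates ::
  "real set \<Rightarrow> frame_index \<Rightarrow> frame_index \<Rightarrow> frame_index \<Rightarrow>
     (real \<Rightarrow> real^3) \<Rightarrow> (real \<Rightarrow> real^3) \<Rightarrow> bool" where
  "mates I v w x \<gamma> \<gamma>' \<longleftrightarrow>
     nondegenerate_curve I \<gamma> \<and> nondegenerate_curve I \<gamma>' \<and>
     (\<exists>l e :: real \<Rightarrow> real.
        smooth_on I (\<lambda>s. (l s, e s)) \<and>
        not_identically_zero_on_subintervals I (\<lambda>s. (l s, e s)) \<and>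
        (\<forall>s\<in>I. \<gamma>' s = \<gamma> s + l s *\<^sub>R frame I \<gamma> v s + e s *\<^sub>R frame I \<gamma> w s \<and>
               (cross3 (frame I \<gamma> v s) (frame I \<gamma> w s) = frame I \<gamma>' x s \<or>
                cross3 (frame I \<gamma> v s) (frame I \<gamma> w s) = - frame I \<gamma>' x s)))"

(* The "other" curve is required to differ from the given one as a map on I. *)

definition bertrand_type ::
  "real set \<Rightarrow> frame_index \<Rightarrow> frame_index \<Rightarrow> frame_index \<Rightarrow> (real \<Rightarrow> real^3) \<Rightarrow> bool" where
  "bertrand_type I v w x \<gamma> \<longleftrightarrow>
     (\<exists>\<gamma>'. nondegenerate_curve I \<gamma>' \<and> (\<exists>s\<in>I. \<gamma>' s \<noteq> \<gamma> s) \<and> mates I v w x \<gamma> \<gamma>')"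

end

theory Submission
  imports Defs
begin

text \<open>
  Differentiating a candidate mate \<open>c = \<gamma> + l t + e n\<close> with the Frenet equations gives
  \<open>c' = (\<sigma> + l' - e \<sigma> \<kappa>) t + (l \<sigma> \<kappa> + e') n + e \<sigma> \<tau> b\<close>, where \<open>\<sigma>\<close> is the speed of \<open>\<gamma>\<close>.
  Since \<open>t \<times> n = b\<close>, the curve \<open>c\<close> is a mate of the required type precisely when \<open>c'\<close> is a nonzero
  multiple of \<open>b\<close> and \<open>c\<close> is non-degenerate. The two differential equations say that the \<open>t\<close>- and
  \<open>n\<close>-components of \<open>c'\<close> vanish, and the remaining component \<open>e \<sigma> \<tau>\<close> can only be nonzero if neither
  \<open>e\<close> nor \<open>\<tau>\<close> vanishes; this already rules out mates as soon as the torsion has a zero.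
  Conversely, if \<open>c' = \<mu> b\<close> with \<open>\<mu> = e \<sigma> \<tau> \<noteq> 0\<close>, then \<open>c'' = \<mu>' b - \<mu> \<sigma> \<tau> n\<close>, so that
  \<open>c' \<times> c'' = \<mu>\<^sup>2 \<sigma> \<tau> t\<close> is nonzero and \<open>c\<close> is automatically non-degenerate; it differs
  from \<open>\<gamma>\<close>, and \<open>(l, e)\<close> vanishes on no subinterval, because \<open>e\<close> has no zero.

  Besides the Frenet equations (\<open>frenet_equations\<close>) this needs the smoothness of the frame, hence the
  closure of \<open>smooth_on\<close> under the operations that build the frame from \<open>\<gamma>\<close>.
\<close>

section \<open>Calculus of smooth functions on an interval\<close>

text \<open>
  A characterisation of smoothness suited to induction on the order: it asks for some derivative, so
  that closure under products, inverses and roots follows by exhibiting one, without appeal to its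
  uniqueness.
\<close>

primrec times_differentiable :: "real set \<Rightarrow> nat \<Rightarrow> (real \<Rightarrow> 'a::real_normed_vector) \<Rightarrow> bool" where
  "times_differentiable I 0 f \<longleftrightarrow> True"
| "times_differentiable I (Suc k) f \<longleftrightarrow>
     (\<exists>f'. (\<forall>s\<in>I. (f has_vector_derivative f' s) (at s within I)) \<and> times_differentiable I k f')"

lemma times_differentiable_SucD: "times_differentiable I (Suc k) f \<Longrightarrow> times_differentiable I k f"
proof (induction k arbitrary: f)
  case (Suc k)
  then obtain f' where "\<forall>s\<in>I. (f has_vector_derivative f' s) (at s within I)"
    "times_differentiable I (Suc k) f'" by auto
  with Suc.IH show ?case by auto
qed simp

lemma times_differentiable_cong:
  assumes "times_differentiable I k f" "\<And>s. s \<in> I \<Longrightarrow> g s = f s"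
  shows "times_differentiable I k g"
proof (cases k)
  case (Suc j)
  with assms obtain f' where f': "\<forall>s\<in>I. (f has_vector_derivative f' s) (at s within I)"
    "times_differentiable I j f'" by auto
  then have "\<forall>s\<in>I. (g has_vector_derivative f' s) (at s within I)"
    using assms(2) has_vector_derivative_transform by blast
  with f' Suc show ?thesis by auto
qed simp

lemma times_differentiable_add:
  "times_differentiable I k f \<Longrightarrow> times_differentiable I k g \<Longrightarrow>
     times_differentiable I k (\<lambda>s. f s + g s)"
proof (induction k arbitrary: f g)
  case (Suc k)
  then obtain f' g' where
    "\<forall>s\<in>I. (f has_vector_derivative f' s) (at s within I)" "times_differentiable I k f'"
    "\<forall>s\<in>I. (g has_vector_derivative g' s) (at s within I)" "times_differentiable I k g'" by auto
  then have "\<forall>s\<in>I. ((\<lambda>s. f s + g s) has_vector_derivative f' s + g' s) (at s within I)"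
    "times_differentiable I k (\<lambda>s. f' s + g' s)"
    using Suc.IH by (auto intro: has_vector_derivative_add)
  then show ?case by auto
qed simp

lemma times_differentiable_linear:
  assumes h: "bounded_linear h"
  shows "times_differentiable I k f \<Longrightarrow> times_differentiable I k (\<lambda>s. h (f s))"
proof (induction k arbitrary: f)
  case (Suc k)
  then obtain f' where
    "\<forall>s\<in>I. (f has_vector_derivative f' s) (at s within I)" "times_differentiable I k f'" by auto
  then have "\<forall>s\<in>I. ((\<lambda>s. h (f s)) has_vector_derivative h (f' s)) (at s within I)"
    "times_differentiable I k (\<lambda>s. h (f' s))"
    using Suc.IH by (auto intro: bounded_linear.has_vector_derivative[OF h])
  then show ?case by auto
qed simp

lemma times_differentiable_bilinear:
  assumes B: "bounded_bilinear B"
  shows "times_differentiable I k f \<Longrightarrow> times_differentiable I k g \<Longrightarrow>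
     times_differentiable I k (\<lambda>s. B (f s) (g s))"
proof (induction k arbitrary: f g)
  case (Suc k)
  then obtain f' g' where *:
    "\<forall>s\<in>I. (f has_vector_derivative f' s) (at s within I)" "times_differentiable I k f'"
    "\<forall>s\<in>I. (g has_vector_derivative g' s) (at s within I)" "times_differentiable I k g'" by auto
  then have "\<forall>s\<in>I. ((\<lambda>s. B (f s) (g s)) has_vector_derivative B (f s) (g' s) + B (f' s) (g s))
      (at s within I)"
    by (auto intro: bounded_bilinear.has_vector_derivative[OF B])
  moreover have "times_differentiable I k (\<lambda>s. B (f s) (g' s) + B (f' s) (g s))"
    using Suc.prems[THEN times_differentiable_SucD] * by (intro times_differentiable_add Suc.IH)
  ultimately show ?case by auto
qed simp

lemmas times_differentiable_mult = times_differentiable_bilinear[OF bounded_bilinear_mult]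

lemma times_differentiable_inverse:
  fixes f :: "real \<Rightarrow> real"
  assumes nz: "\<And>s. s \<in> I \<Longrightarrow> f s \<noteq> 0"
  shows "times_differentiable I k f \<Longrightarrow> times_differentiable I k (\<lambda>s. inverse (f s))"
proof (induction k)
  case (Suc k)
  then obtain f' where *:
    "\<forall>s\<in>I. (f has_vector_derivative f' s) (at s within I)" "times_differentiable I k f'" by auto
  let ?d = "\<lambda>s. - (inverse (f s) * f' s * inverse (f s))"
  have "\<forall>s\<in>I. ((\<lambda>s. inverse (f s)) has_vector_derivative ?d s) (at s within I)"
    using * nz unfolding has_real_derivative_iff_has_vector_derivative[symmetric]
    by (auto intro: DERIV_inverse')
  moreover have "times_differentiable I k ?d"
    using Suc.IH[OF times_differentiable_SucD[OF Suc.prems]] *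
    by (intro times_differentiable_linear[OF bounded_linear_minus[OF bounded_linear_ident]]
        times_differentiable_mult)
  ultimately show ?case by auto
qed simp

lemma times_differentiable_sqrt:
  fixes f :: "real \<Rightarrow> real"
  assumes pos: "\<And>s. s \<in> I \<Longrightarrow> f s > 0"
  shows "times_differentiable I k f \<Longrightarrow> times_differentiable I k (\<lambda>s. sqrt (f s))"
proof (induction k)
  case (Suc k)
  then obtain f' where *:
    "\<forall>s\<in>I. (f has_vector_derivative f' s) (at s within I)" "times_differentiable I k f'" by auto
  let ?d = "\<lambda>s. (inverse (sqrt (f s)) * f' s) / 2"
  have "\<forall>s\<in>I. ((\<lambda>s. sqrt (f s)) has_vector_derivative ?d s) (at s within I)"
    using * pos unfolding has_real_derivative_iff_has_vector_derivative[symmetric]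
    by (fastforce intro!: derivative_eq_intros simp: field_simps)
  moreover have "times_differentiable I k ?d"
    using Suc.IH[OF times_differentiable_SucD[OF Suc.prems]] * pos
    by (intro times_differentiable_linear[OF bounded_linear_divide]
        times_differentiable_mult times_differentiable_inverse) fastforce+
  ultimately show ?case by auto
qed simp

lemma nth_deriv_Suc_shift: "nth_deriv I (Suc k) f = nth_deriv I k (nth_deriv I 1 f)"
  by (induction k) auto

lemma differentiable_iff_nth_deriv_1:
  "f differentiable (at s within I) \<longleftrightarrow> (f has_vector_derivative nth_deriv I 1 f s) (at s within I)"
  by (simp add: vector_derivative_works)

context
  fixes I :: "real set"
  assumes I: "nontrivial_interval I"
begin

text \<open>Derivatives within the interval are unique because it has no isolated points.\<close>

lemma nth_deriv_1_eq:
  assumes "s \<in> I" "(f has_vector_derivative d) (at s within I)"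
  shows "nth_deriv I 1 f s = d"
proof -
  have "connected I" "\<And>x. I \<noteq> {x}"
    using I by (auto simp: nontrivial_interval_def is_interval_connected_1)
  then have "at s within I \<noteq> bot"
    using connected_imp_perfect \<open>s \<in> I\<close> by (auto simp: trivial_limit_within)
  with assms show ?thesis by (simp add: vector_derivative_within)
qed

lemma times_differentiable_iff:
  "times_differentiable I k f \<longleftrightarrow>
     (\<forall>j<k. \<forall>s\<in>I. nth_deriv I j f differentiable (at s within I))"
proof (induction k arbitrary: f)
  case (Suc k)
  have "times_differentiable I (Suc k) f \<longleftrightarrow>
      (\<forall>s\<in>I. f differentiable (at s within I)) \<and> times_differentiable I k (nth_deriv I 1 f)"
  proof
    assume "times_differentiable I (Suc k) f"
    then obtain f' where f': "\<forall>s\<in>I. (f has_vector_derivative f' s) (at s within I)"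
      "times_differentiable I k f'" by auto
    moreover have "times_differentiable I k (nth_deriv I 1 f)"
      using f' nth_deriv_1_eq by (intro times_differentiable_cong[OF f'(2)]) blast
    ultimately show "(\<forall>s\<in>I. f differentiable (at s within I)) \<and>
        times_differentiable I k (nth_deriv I 1 f)"
      by (auto intro: differentiableI_vector)
  qed (unfold differentiable_iff_nth_deriv_1, auto)
  also have "\<dots> \<longleftrightarrow> (\<forall>j<Suc k. \<forall>s\<in>I. nth_deriv I j f differentiable (at s within I))"
    unfolding Suc.IH All_less_Suc2 nth_deriv_Suc_shift by simp
  finally show ?case .
qed simp

lemma smooth_on_iff: "smooth_on I f \<longleftrightarrow> (\<forall>k. times_differentiable I k f)"
  unfolding smooth_on_def times_differentiable_iff by blast

lemma smooth_on_has_vector_derivative: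
  "smooth_on I f \<Longrightarrow> s \<in> I \<Longrightarrow> (f has_vector_derivative nth_deriv I 1 f s) (at s within I)"
  unfolding smooth_on_def differentiable_iff_nth_deriv_1[symmetric] by (metis nth_deriv.simps(1))

lemma smooth_on_nth_deriv: "smooth_on I f \<Longrightarrow> smooth_on I (nth_deriv I 1 f)"
  unfolding smooth_on_def nth_deriv_Suc_shift[symmetric] by blast

lemma smooth_on_cong: "smooth_on I f \<Longrightarrow> (\<And>s. s \<in> I \<Longrightarrow> g s = f s) \<Longrightarrow> smooth_on I g"
  unfolding smooth_on_iff using times_differentiable_cong by blast

lemma smooth_on_add: "smooth_on I f \<Longrightarrow> smooth_on I g \<Longrightarrow> smooth_on I (\<lambda>s. f s + g s)"
  unfolding smooth_on_iff using times_differentiable_add by blast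

lemma smooth_on_linear: "bounded_linear h \<Longrightarrow> smooth_on I f \<Longrightarrow> smooth_on I (\<lambda>s. h (f s))"
  unfolding smooth_on_iff using times_differentiable_linear by blast

lemma smooth_on_bilinear:
  "bounded_bilinear B \<Longrightarrow> smooth_on I f \<Longrightarrow> smooth_on I g \<Longrightarrow> smooth_on I (\<lambda>s. B (f s) (g s))"
  unfolding smooth_on_iff using times_differentiable_bilinear by blast

lemma smooth_on_inverse_norm:
  fixes f :: "real \<Rightarrow> 'a::real_inner"
  assumes "smooth_on I f" "\<And>s. s \<in> I \<Longrightarrow> f s \<noteq> 0"
  shows "smooth_on I (\<lambda>s. inverse (norm (f s)))"
  unfolding smooth_on_iff norm_eq_sqrt_inner using assms
  by (auto intro!: times_differentiable_inverse times_differentiable_sqrt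
      times_differentiable_bilinear[OF bounded_bilinear_inner] simp: smooth_on_iff)

lemma inner_derivative_antisymmetric:
  fixes f g :: "real \<Rightarrow> 'a::real_inner"
  assumes "s \<in> I" "\<And>s. s \<in> I \<Longrightarrow> f s \<bullet> g s = c"
    and "(f has_vector_derivative f') (at s within I)" "(g has_vector_derivative g') (at s within I)"
  shows "f' \<bullet> g s = - (g' \<bullet> f s)"
proof -
  have "((\<lambda>s. f s \<bullet> g s) has_vector_derivative f s \<bullet> g' + f' \<bullet> g s) (at s within I)"
    by (rule bounded_bilinear.has_vector_derivative[OF bounded_bilinear_inner assms(3,4)])
  from nth_deriv_1_eq[OF assms(1) this]
  have "nth_deriv I 1 (\<lambda>s. f s \<bullet> g s) s = f s \<bullet> g' + f' \<bullet> g s" .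
  moreover have "nth_deriv I 1 (\<lambda>s. f s \<bullet> g s) s = 0"
    using assms(1,2) by (intro nth_deriv_1_eq has_vector_derivative_transform[OF _ _
        has_vector_derivative_const[of c]]) auto
  ultimately show ?thesis by (simp add: inner_commute)
qed

end

section \<open>The Frenet frame\<close>

unbundle cross3_syntax

lemma bounded_bilinear_cross3: "bounded_bilinear cross3"
  using bilinear_conv_bounded_bilinear bilinear_cross by blast

lemmas smooth_on_cross3 = smooth_on_bilinear[OF _ bounded_bilinear_cross3]
  and smooth_on_scaleR = smooth_on_bilinear[OF _ bounded_bilinear_scaleR]
  and has_vector_derivative_cross3 = bounded_bilinear.has_vector_derivative[OF bounded_bilinear_cross3]
  and has_vector_derivative_scaleR_vec = bounded_bilinear.has_vector_derivative[OF bounded_bilinear_scaleR]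

text \<open>
  Subtracting the three components leaves a vector orthogonal to \<open>t\<close> and \<open>b\<close>, hence by Lagrange's
  identity parallel to \<open>b \<times> t\<close>; being orthogonal to that vector as well, it vanishes.
\<close>

lemma orthonormal_expansion:
  fixes t b v :: "real^3"
  assumes t: "t \<bullet> t = 1" and b: "b \<bullet> b = 1" and tb: "t \<bullet> b = 0"
  shows "v = (v \<bullet> t) *\<^sub>R t + (v \<bullet> (b \<times> t)) *\<^sub>R (b \<times> t) + (v \<bullet> b) *\<^sub>R b"
proof -
  define n where "n = b \<times> t"
  have bt: "b \<bullet> t = 0" using tb by (simp add: inner_commute)
  have n: "n \<bullet> t = 0" "n \<bullet> b = 0" "t \<bullet> n = 0" "b \<bullet> n = 0" unfolding n_def by (simp_all add: dot_cross_self)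
  have "(norm n)\<^sup>2 = 1" using norm_cross_dot[of b t] t b tb bt
    by (simp add: n_def power2_norm_eq_inner norm_eq_sqrt_inner)
  then have nn: "n \<bullet> n = 1" by (simp add: power2_norm_eq_inner)
  define w where "w = v - ((v \<bullet> t) *\<^sub>R t + (v \<bullet> n) *\<^sub>R n + (v \<bullet> b) *\<^sub>R b)"
  have w: "w \<bullet> t = 0" "w \<bullet> b = 0" "w \<bullet> n = 0"
    unfolding w_def by (simp_all add: inner_diff_left inner_add_left t b tb bt n nn)
  have "w \<times> n = 0" unfolding n_def Lagrange by (simp add: w)
  then have "n \<times> (w \<times> n) = 0" by simp
  then have "w = 0" unfolding Lagrange using nn w by (simp add: inner_commute)
  then show ?thesis unfolding w_def n_def by simp
qed

context
  fixes I :: "real set" and \<gamma> :: "real \<Rightarrow> real^3"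
  assumes I: "nontrivial_interval I" and \<gamma>: "nondegenerate_curve I \<gamma>"
begin

lemma velocity_nonzero: "s \<in> I \<Longrightarrow> nth_deriv I 1 \<gamma> s \<noteq> 0"
  and velocity_cross_acceleration_nonzero: "s \<in> I \<Longrightarrow> nth_deriv I 1 \<gamma> s \<times> nth_deriv I 2 \<gamma> s \<noteq> 0"
  and smooth_on_nondegenerate_curve: "smooth_on I \<gamma>"
  using \<gamma> unfolding nondegenerate_curve_def by blast+

lemma nth_deriv_2_eq: "nth_deriv I 2 \<gamma> = nth_deriv I 1 (nth_deriv I 1 \<gamma>)"
  and nth_deriv_3_eq: "nth_deriv I 3 \<gamma> = nth_deriv I 1 (nth_deriv I 2 \<gamma>)"
  by (simp_all add: numeral_2_eq_2 numeral_3_eq_3)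

lemma smooth_on_velocity: "smooth_on I (nth_deriv I 1 \<gamma>)"
  and smooth_on_acceleration: "smooth_on I (nth_deriv I 2 \<gamma>)"
  unfolding nth_deriv_2_eq by (intro smooth_on_nth_deriv smooth_on_nondegenerate_curve I)+

lemma smooth_on_tangent: "smooth_on I (tangent I \<gamma>)"
  unfolding tangent_def[abs_def]
  by (intro smooth_on_scaleR smooth_on_inverse_norm I smooth_on_velocity velocity_nonzero)

lemma smooth_on_binormal: "smooth_on I (binormal I \<gamma>)"
  unfolding binormal_def[abs_def]
  by (intro smooth_on_scaleR smooth_on_inverse_norm smooth_on_cross3 I smooth_on_velocity
      smooth_on_acceleration velocity_cross_acceleration_nonzero)

lemma smooth_on_principal_normal: "smooth_on I (principal_normal I \<gamma>)"
  unfolding principal_normal_def[abs_def]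
  by (intro smooth_on_cross3 smooth_on_tangent smooth_on_binormal I)

lemma speed_pos: "s \<in> I \<Longrightarrow> speed I \<gamma> s > 0"
  using velocity_nonzero by (simp add: speed_def)

lemma velocity_eq: "s \<in> I \<Longrightarrow> nth_deriv I 1 \<gamma> s = speed I \<gamma> s *\<^sub>R tangent I \<gamma> s"
  using velocity_nonzero[of s] by (simp add: speed_def tangent_def)

lemma frame_orthonormal:
  assumes "s \<in> I"
  shows "tangent I \<gamma> s \<bullet> tangent I \<gamma> s = 1" "binormal I \<gamma> s \<bullet> binormal I \<gamma> s = 1"
    "principal_normal I \<gamma> s \<bullet> principal_normal I \<gamma> s = 1"
    "tangent I \<gamma> s \<bullet> binormal I \<gamma> s = 0" "binormal I \<gamma> s \<bullet> tangent I \<gamma> s = 0"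
    "tangent I \<gamma> s \<bullet> principal_normal I \<gamma> s = 0" "principal_normal I \<gamma> s \<bullet> tangent I \<gamma> s = 0"
    "binormal I \<gamma> s \<bullet> principal_normal I \<gamma> s = 0" "principal_normal I \<gamma> s \<bullet> binormal I \<gamma> s = 0"
proof -
  have t: "norm (tangent I \<gamma> s) = 1" and b: "norm (binormal I \<gamma> s) = 1"
    using velocity_nonzero velocity_cross_acceleration_nonzero assms
    by (simp_all add: tangent_def binormal_def)
  show tb: "tangent I \<gamma> s \<bullet> binormal I \<gamma> s = 0"
    by (simp add: tangent_def binormal_def dot_cross_self)
  then show bt: "binormal I \<gamma> s \<bullet> tangent I \<gamma> s = 0" by (simp add: inner_commute)
  show "tangent I \<gamma> s \<bullet> tangent I \<gamma> s = 1" "binormal I \<gamma> s \<bullet> binormal I \<gamma> s = 1"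
    using t b by (simp_all add: norm_eq_1)
  have "(norm (principal_normal I \<gamma> s))\<^sup>2 = 1"
    using norm_cross_dot[of "binormal I \<gamma> s" "tangent I \<gamma> s"] t b bt
    by (simp add: principal_normal_def)
  then show "principal_normal I \<gamma> s \<bullet> principal_normal I \<gamma> s = 1" by (simp add: power2_norm_eq_inner)
qed (simp_all add: principal_normal_def dot_cross_self)

lemma frame_cross:
  assumes "s \<in> I"
  shows "binormal I \<gamma> s \<times> tangent I \<gamma> s = principal_normal I \<gamma> s"
    "tangent I \<gamma> s \<times> principal_normal I \<gamma> s = binormal I \<gamma> s"
    "principal_normal I \<gamma> s \<times> binormal I \<gamma> s = tangent I \<gamma> s"
proof -
  show "tangent I \<gamma> s \<times> principal_normal I \<gamma> s = binormal I \<gamma> s"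
    unfolding principal_normal_def Lagrange by (simp add: frame_orthonormal assms)
  have "binormal I \<gamma> s \<times> principal_normal I \<gamma> s = - tangent I \<gamma> s"
    unfolding principal_normal_def Lagrange by (simp add: frame_orthonormal assms)
  then show "principal_normal I \<gamma> s \<times> binormal I \<gamma> s = tangent I \<gamma> s"
    using cross_skew[of "principal_normal I \<gamma> s"] by simp
qed (simp add: principal_normal_def)

lemma frame_expansion:
  assumes "s \<in> I"
  shows "v = (v \<bullet> tangent I \<gamma> s) *\<^sub>R tangent I \<gamma> s
    + (v \<bullet> principal_normal I \<gamma> s) *\<^sub>R principal_normal I \<gamma> s
    + (v \<bullet> binormal I \<gamma> s) *\<^sub>R binormal I \<gamma> s"
  unfolding principal_normal_def by (rule orthonormal_expansion) (simp_all add: frame_orthonormal assms)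

text \<open>
  Orthonormality of the frame makes the matrix of its derivative antisymmetric, so only the normal
  components of \<open>t'\<close> and \<open>b'\<close> and the vanishing of \<open>t' \<bullet> b\<close> need the defining formulas. Since \<open>t\<close>
  and \<open>b\<close> are normalisations of \<open>\<gamma>'\<close> and \<open>\<gamma>' \<times> \<gamma>''\<close>, the derivatives of the normalising factors
  contribute only multiples of \<open>t\<close> and of \<open>b\<close>, which these components do not see. The equation for
  \<open>n'\<close> is then the product rule for \<open>n = b \<times> t\<close>.
\<close>

lemma frenet_equations:
  assumes s: "s \<in> I"
  shows "(tangent I \<gamma> has_vector_derivative
      (speed I \<gamma> s * curvature I \<gamma> s) *\<^sub>R principal_normal I \<gamma> s) (at s within I)" (is ?T)
    and "(binormal I \<gamma> has_vector_derivative
      - (speed I \<gamma> s * torsion I \<gamma> s) *\<^sub>R principal_normal I \<gamma> s) (at s within I)" (is ?B)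
    and "(principal_normal I \<gamma> has_vector_derivative
      (speed I \<gamma> s * torsion I \<gamma> s) *\<^sub>R binormal I \<gamma> s
        - (speed I \<gamma> s * curvature I \<gamma> s) *\<^sub>R tangent I \<gamma> s) (at s within I)" (is ?N)
proof -
  let ?t = "tangent I \<gamma>" and ?n = "principal_normal I \<gamma>" and ?b = "binormal I \<gamma>"
  let ?t' = "nth_deriv I 1 ?t s" and ?b' = "nth_deriv I 1 ?b s"
  define x y z where "x = nth_deriv I 1 \<gamma> s" and "y = nth_deriv I 2 \<gamma> s" and "z = nth_deriv I 3 \<gamma> s"
  define \<sigma> N where "\<sigma> = norm x" and "N = norm (x \<times> y)"
  have pos: "\<sigma> > 0" "N > 0"
    using velocity_nonzero velocity_cross_acceleration_nonzero s
    by (auto simp: \<sigma>_def N_def x_def y_def)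
  have ts: "?t s = x /\<^sub>R \<sigma>" and bs: "?b s = (x \<times> y) /\<^sub>R N"
    by (simp_all add: tangent_def binormal_def x_def y_def \<sigma>_def N_def)
  have ns: "?n s = ((x \<times> y) \<times> x) /\<^sub>R (N * \<sigma>)"
    by (simp add: principal_normal_def ts bs cross_mult_left cross_mult_right)
  have \<sigma>: "speed I \<gamma> s = \<sigma>" "curvature I \<gamma> s = N / \<sigma> ^ 3" "torsion I \<gamma> s = x \<bullet> (y \<times> z) / N\<^sup>2"
    by (simp_all add: speed_def curvature_def torsion_def dot_cross_det \<sigma>_def N_def x_def y_def z_def)
  have t': "(?t has_vector_derivative ?t') (at s within I)"
    and b': "(?b has_vector_derivative ?b') (at s within I)"
    by (intro smooth_on_has_vector_derivative I s smooth_on_tangent smooth_on_binormal)+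
  have dx: "(nth_deriv I 1 \<gamma> has_vector_derivative y) (at s within I)"
    unfolding y_def nth_deriv_2_eq by (intro smooth_on_has_vector_derivative I s smooth_on_velocity)
  have dy: "(nth_deriv I 2 \<gamma> has_vector_derivative z) (at s within I)"
    unfolding z_def nth_deriv_3_eq by (intro smooth_on_has_vector_derivative I s smooth_on_acceleration)
  have dxy: "((\<lambda>s. nth_deriv I 1 \<gamma> s \<times> nth_deriv I 2 \<gamma> s) has_vector_derivative x \<times> z) (at s within I)"
    using has_vector_derivative_cross3[OF dx dy] by (simp add: x_def y_def)
  obtain p where "((\<lambda>s. inverse (norm (nth_deriv I 1 \<gamma> s))) has_vector_derivative p) (at s within I)"
    using smooth_on_has_vector_derivative[OF I smooth_on_inverse_norm[OF I smooth_on_velocity] s]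
      velocity_nonzero by blast
  from has_vector_derivative_scaleR_vec[OF this dx]
  have t'_eq: "?t' = y /\<^sub>R \<sigma> + p *\<^sub>R x"
    by (intro nth_deriv_1_eq[OF I s]) (simp add: tangent_def[abs_def] \<sigma>_def x_def)
  obtain q where "((\<lambda>s. inverse (norm (nth_deriv I 1 \<gamma> s \<times> nth_deriv I 2 \<gamma> s)))
      has_vector_derivative q) (at s within I)"
    using smooth_on_has_vector_derivative[OF I smooth_on_inverse_norm[OF I
          smooth_on_cross3[OF I smooth_on_velocity smooth_on_acceleration]] s]
      velocity_cross_acceleration_nonzero by blast
  from has_vector_derivative_scaleR_vec[OF this dxy]
  have b'_eq: "?b' = (x \<times> z) /\<^sub>R N + q *\<^sub>R (x \<times> y)"
    by (intro nth_deriv_1_eq[OF I s]) (simp add: binormal_def[abs_def] N_def x_def y_def)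
  have "y \<bullet> ((x \<times> y) \<times> x) = (x \<times> y) \<bullet> (x \<times> y)"
    by (simp add: cross3_simps)
  also have "\<dots> = N\<^sup>2" by (simp add: N_def power2_norm_eq_inner)
  finally have "?t' \<bullet> ?n s = N / \<sigma>\<^sup>2"
    unfolding t'_eq ns using pos
    by (simp add: inner_add_left dot_cross_self field_simps power2_eq_square)
  then have t'n: "?t' \<bullet> ?n s = speed I \<gamma> s * curvature I \<gamma> s"
    unfolding \<sigma> using pos by (simp add: field_simps power2_eq_square power3_eq_cube)
  have "(x \<times> z) \<bullet> ((x \<times> y) \<times> x) = - (x \<bullet> x) * (x \<bullet> (y \<times> z))"
    by (simp add: cross3_simps)
  also have "x \<bullet> x = \<sigma>\<^sup>2" by (simp add: \<sigma>_def power2_norm_eq_inner)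
  finally have b'n: "?b' \<bullet> ?n s = - (speed I \<gamma> s * torsion I \<gamma> s)"
    unfolding b'_eq ns \<sigma> using pos
    by (simp add: inner_add_left dot_cross_self field_simps power2_eq_square)
  have t'b: "?t' \<bullet> ?b s = 0"
    unfolding t'_eq bs by (simp add: inner_add_left dot_cross_self)
  have t't: "?t' \<bullet> ?t s = 0"
    using inner_derivative_antisymmetric[OF I s _ t' t'] frame_orthonormal by force
  have b'b: "?b' \<bullet> ?b s = 0"
    using inner_derivative_antisymmetric[OF I s _ b' b'] frame_orthonormal by force
  have b't: "?b' \<bullet> ?t s = 0"
    using inner_derivative_antisymmetric[OF I s _ b' t'] frame_orthonormal t'b by force
  have t'_frame: "?t' = (speed I \<gamma> s * curvature I \<gamma> s) *\<^sub>R ?n s"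
    using frame_expansion[OF s, of ?t'] t't t'n t'b by simp
  have b'_frame: "?b' = - (speed I \<gamma> s * torsion I \<gamma> s) *\<^sub>R ?n s"
    using frame_expansion[OF s, of ?b'] b't b'n b'b by simp
  show T: ?T using t' unfolding t'_frame .
  show B: ?B using b' unfolding b'_frame .
  have "?n s \<times> ?t s = - ?b s" "?b s \<times> ?n s = - ?t s"
    using frame_cross[OF s] cross_skew by metis+
  moreover have "principal_normal I \<gamma> = (\<lambda>s. ?b s \<times> ?t s)" by (simp add: fun_eq_iff principal_normal_def)
  ultimately show ?N
    using has_vector_derivative_cross3[OF B T]
    by (simp add: cross_mult_left cross_mult_right algebra_simps)
qed

section \<open>Curves in the osculating planes\<close>

lemma osculating_combination_derivative:
  assumes s: "s \<in> I" and l: "smooth_on I l" and e: "smooth_on I e"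
  shows "((\<lambda>s. \<gamma> s + l s *\<^sub>R tangent I \<gamma> s + e s *\<^sub>R principal_normal I \<gamma> s) has_vector_derivative
     (speed I \<gamma> s + nth_deriv I 1 l s - e s * speed I \<gamma> s * curvature I \<gamma> s) *\<^sub>R tangent I \<gamma> s
     + (l s * speed I \<gamma> s * curvature I \<gamma> s + nth_deriv I 1 e s) *\<^sub>R principal_normal I \<gamma> s
     + (e s * speed I \<gamma> s * torsion I \<gamma> s) *\<^sub>R binormal I \<gamma> s) (at s within I)"
proof -
  note d = smooth_on_has_vector_derivative[OF I _ s]
  have "((\<lambda>s. \<gamma> s + l s *\<^sub>R tangent I \<gamma> s + e s *\<^sub>R principal_normal I \<gamma> s) has_vector_derivative
     nth_deriv I 1 \<gamma> s
     + (l s *\<^sub>R (speed I \<gamma> s * curvature I \<gamma> s) *\<^sub>R principal_normal I \<gamma> s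
        + nth_deriv I 1 l s *\<^sub>R tangent I \<gamma> s)
     + (e s *\<^sub>R ((speed I \<gamma> s * torsion I \<gamma> s) *\<^sub>R binormal I \<gamma> s
        - (speed I \<gamma> s * curvature I \<gamma> s) *\<^sub>R tangent I \<gamma> s)
        + nth_deriv I 1 e s *\<^sub>R principal_normal I \<gamma> s)) (at s within I)"
    by (intro has_vector_derivative_add has_vector_derivative_scaleR_vec frenet_equations s
        d[OF l] d[OF e] d[OF smooth_on_nondegenerate_curve])
  then show ?thesis unfolding velocity_eq[OF s] by (simp add: algebra_simps)
qed

text \<open>
  The velocity of a mate is parallel to its unit tangent \<open>\<plusminus> b\<close>, so its \<open>t\<close>- and \<open>n\<close>-components vanish,
  and its \<open>b\<close>-component does not because a mate is regular.
\<close>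

lemma mate_conditions:
  assumes "mates I Tangent Normal Tangent \<gamma> c"
  shows "\<exists>l e. smooth_on I (\<lambda>s. (l s, e s)) \<and>
    (\<forall>s\<in>I. e s \<noteq> 0 \<and> torsion I \<gamma> s \<noteq> 0 \<and>
       speed I \<gamma> s + nth_deriv I 1 l s - e s * speed I \<gamma> s * curvature I \<gamma> s = 0 \<and>
       l s * speed I \<gamma> s * curvature I \<gamma> s + nth_deriv I 1 e s = 0)"
proof -
  from assms obtain l e where c: "nondegenerate_curve I c" and sm: "smooth_on I (\<lambda>s. (l s, e s))"
    and ceq: "\<And>s. s \<in> I \<Longrightarrow> c s = \<gamma> s + l s *\<^sub>R tangent I \<gamma> s + e s *\<^sub>R principal_normal I \<gamma> s"
    and par: "\<And>s. s \<in> I \<Longrightarrow> tangent I \<gamma> s \<times> principal_normal I \<gamma> s = tangent I c s \<or>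
        tangent I \<gamma> s \<times> principal_normal I \<gamma> s = - tangent I c s"
    unfolding mates_def by auto
  have l: "smooth_on I l" and e: "smooth_on I e"
    using smooth_on_linear[OF I bounded_linear_fst sm] smooth_on_linear[OF I bounded_linear_snd sm]
    by simp_all
  show ?thesis
  proof (rule exI[of _ l], rule exI[of _ e], rule conjI[OF sm], rule ballI)
    fix s assume s: "s \<in> I"
    let ?t = "tangent I \<gamma> s" and ?n = "principal_normal I \<gamma> s" and ?b = "binormal I \<gamma> s"
    let ?v = "nth_deriv I 1 c s"
    have v: "?v =
       (speed I \<gamma> s + nth_deriv I 1 l s - e s * speed I \<gamma> s * curvature I \<gamma> s) *\<^sub>R ?t
       + (l s * speed I \<gamma> s * curvature I \<gamma> s + nth_deriv I 1 e s) *\<^sub>R ?n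
       + (e s * speed I \<gamma> s * torsion I \<gamma> s) *\<^sub>R ?b" (is "_ = ?p *\<^sub>R _ + ?q *\<^sub>R _ + ?r *\<^sub>R _")
      by (rule nth_deriv_1_eq[OF I s has_vector_derivative_transform[OF s ceq
            osculating_combination_derivative[OF s l e]]])
    have v0: "?v \<noteq> 0" using c s unfolding nondegenerate_curve_def by blast
    have "?v = norm ?v *\<^sub>R tangent I c s" using v0 by (simp add: tangent_def)
    then obtain r where "?v = r *\<^sub>R ?b"
      using par[OF s] frame_cross[OF s] by (metis minus_minus scaleR_minus_left scaleR_minus_right)
    then have "?v \<bullet> ?t = 0" "?v \<bullet> ?n = 0" by (simp_all add: frame_orthonormal s)
    then have "?p = 0" "?q = 0" unfolding v by (simp_all add: inner_add_left frame_orthonormal s)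
    moreover from this v v0 have "?r \<noteq> 0" by auto
    ultimately show "e s \<noteq> 0 \<and> torsion I \<gamma> s \<noteq> 0 \<and> ?p = 0 \<and> ?q = 0" by auto
  qed
qed

text \<open>
  A curve whose velocity is a nonzero multiple of the binormal turns towards the normal at a rate
  proportional to the torsion, hence is non-degenerate where the torsion does not vanish.
\<close>

lemma nondegenerate_if_velocity_binormal:
  assumes c: "smooth_on I c"
    and velocity: "\<And>s. s \<in> I \<Longrightarrow> nth_deriv I 1 c s = \<mu> s *\<^sub>R binormal I \<gamma> s"
    and nz: "\<And>s. s \<in> I \<Longrightarrow> \<mu> s \<noteq> 0" "\<And>s. s \<in> I \<Longrightarrow> torsion I \<gamma> s \<noteq> 0"
  shows "nondegenerate_curve I c"
proof -
  have "smooth_on I (\<lambda>s. nth_deriv I 1 c s \<bullet> binormal I \<gamma> s)"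
    by (intro smooth_on_bilinear[OF I bounded_bilinear_inner] smooth_on_nth_deriv c I smooth_on_binormal)
  \<comment> \<open>The factor \<open>\<mu>\<close> is smooth because it is the inner product of the velocity with the binormal.\<close>
  then have \<mu>: "smooth_on I \<mu>"
    by (rule smooth_on_cong[OF I]) (simp only: velocity inner_scaleR_left frame_orthonormal mult_1_right)
  have "nth_deriv I 1 c s \<noteq> 0 \<and> nth_deriv I 1 c s \<times> nth_deriv I 2 c s \<noteq> 0" if s: "s \<in> I" for s
  proof -
    let ?t = "tangent I \<gamma> s" and ?n = "principal_normal I \<gamma> s" and ?b = "binormal I \<gamma> s"
    have unit: "?b \<noteq> 0" "?t \<noteq> 0" using frame_orthonormal[OF s] by auto
    have "nth_deriv I 2 c s = nth_deriv I 1 (nth_deriv I 1 c) s" by (simp add: numeral_2_eq_2)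
    also have "\<dots> = \<mu> s *\<^sub>R (- (speed I \<gamma> s * torsion I \<gamma> s) *\<^sub>R ?n) + nth_deriv I 1 \<mu> s *\<^sub>R ?b"
      by (rule nth_deriv_1_eq[OF I s has_vector_derivative_transform[OF s velocity
            has_vector_derivative_scaleR_vec[OF smooth_on_has_vector_derivative[OF I \<mu> s]
              frenet_equations(2)[OF s]]]])
    finally have "nth_deriv I 1 c s \<times> nth_deriv I 2 c s
        = - ((\<mu> s)\<^sup>2 * speed I \<gamma> s * torsion I \<gamma> s) *\<^sub>R (?b \<times> ?n)"
      unfolding velocity[OF s]
      by (simp add: cross_mult_left cross_mult_right Cross3.right_diff_distrib
          power2_eq_square mult.assoc)
    also have "?b \<times> ?n = - ?t" using frame_cross[OF s] cross_skew by metis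
    finally show ?thesis unfolding velocity[OF s] using unit nz[OF s] speed_pos[OF s] by simp
  qed
  with c show ?thesis unfolding nondegenerate_curve_def by blast
qed

lemma bertrand_type_if_conditions:
  assumes \<tau>: "\<And>s. s \<in> I \<Longrightarrow> torsion I \<gamma> s \<noteq> 0" and sm: "smooth_on I (\<lambda>s. (l s, e s))"
    and conditions: "\<And>s. s \<in> I \<Longrightarrow> e s \<noteq> 0 \<and>
       speed I \<gamma> s + nth_deriv I 1 l s - e s * speed I \<gamma> s * curvature I \<gamma> s = 0 \<and>
       l s * speed I \<gamma> s * curvature I \<gamma> s + nth_deriv I 1 e s = 0"
  shows "bertrand_type I Tangent Normal Tangent \<gamma>"
proof -
  have l: "smooth_on I l" and e: "smooth_on I e"
    using smooth_on_linear[OF I bounded_linear_fst sm] smooth_on_linear[OF I bounded_linear_snd sm]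
    by simp_all
  define c where "c = (\<lambda>s. \<gamma> s + l s *\<^sub>R tangent I \<gamma> s + e s *\<^sub>R principal_normal I \<gamma> s)"
  define \<mu> where "\<mu> = (\<lambda>s. e s * speed I \<gamma> s * torsion I \<gamma> s)"
  have c: "smooth_on I c" unfolding c_def
    by (intro smooth_on_add smooth_on_scaleR I l e smooth_on_tangent smooth_on_principal_normal
        smooth_on_nondegenerate_curve)
  have velocity: "nth_deriv I 1 c s = \<mu> s *\<^sub>R binormal I \<gamma> s" if s: "s \<in> I" for s
    using osculating_combination_derivative[OF s l e] conditions[OF s]
    by (intro nth_deriv_1_eq[OF I s]) (simp add: c_def \<mu>_def)
  have \<mu>: "\<mu> s \<noteq> 0" if "s \<in> I" for s
    using conditions[OF that] \<tau>[OF that] speed_pos[OF that] by (simp add: \<mu>_def)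
  have nd: "nondegenerate_curve I c"
    using c velocity \<mu> \<tau> by (rule nondegenerate_if_velocity_binormal)
  have par: "tangent I \<gamma> s \<times> principal_normal I \<gamma> s = tangent I c s \<or>
      tangent I \<gamma> s \<times> principal_normal I \<gamma> s = - tangent I c s" if s: "s \<in> I" for s
  proof -
    have "norm (binormal I \<gamma> s) = 1" by (simp add: norm_eq_1 frame_orthonormal s)
    then have "tangent I c s = (\<mu> s / \<bar>\<mu> s\<bar>) *\<^sub>R binormal I \<gamma> s"
      unfolding tangent_def velocity[OF s] by (simp add: divide_inverse_commute)
    then show ?thesis using \<mu>[OF s] frame_cross[OF s] by (cases "\<mu> s > 0") auto
  qed
  have "not_identically_zero_on_subintervals I (\<lambda>s. (l s, e s))"
    unfolding not_identically_zero_on_subintervals_def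
    using conditions by (auto simp: nontrivial_interval_def zero_prod_def)
  with sm nd \<gamma> par have "mates I Tangent Normal Tangent \<gamma> c"
    unfolding mates_def by (auto simp: c_def)
  moreover have "\<exists>s\<in>I. c s \<noteq> \<gamma> s"
  proof -
    obtain s where s: "s \<in> I" using I by (auto simp: nontrivial_interval_def)
    have "(c s - \<gamma> s) \<bullet> principal_normal I \<gamma> s = e s"
      by (simp add: c_def inner_add_left frame_orthonormal s)
    then show ?thesis using conditions[OF s] s by force
  qed
  ultimately show ?thesis using nd unfolding bertrand_type_def by blast
qed

end

theorem theorem3p5:
  fixes I :: "real set" and \<gamma> :: "real \<Rightarrow> real^3"
  assumes "nontrivial_interval I"
    and "nondegenerate_curve I \<gamma>"
  shows "((\<forall>s\<in>I. torsion I \<gamma> s \<noteq> 0) \<longrightarrow>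
      (bertrand_type I Tangent Normal Tangent \<gamma> \<longleftrightarrow>
        (\<exists>l e :: real \<Rightarrow> real.
           smooth_on I (\<lambda>s. (l s, e s)) \<and>
           (\<forall>s\<in>I. e s \<noteq> 0 \<and>
              speed I \<gamma> s + nth_deriv I 1 l s - e s * speed I \<gamma> s * curvature I \<gamma> s = 0 \<and>
              l s * speed I \<gamma> s * curvature I \<gamma> s + nth_deriv I 1 e s = 0)))) \<and>
    ((\<exists>s\<in>I. torsion I \<gamma> s = 0) \<longrightarrow> \<not> bertrand_type I Tangent Normal Tangent \<gamma>)"
proof (intro conjI impI iffI)
  assume "bertrand_type I Tangent Normal Tangent \<gamma>"
  then obtain c where "mates I Tangent Normal Tangent \<gamma> c"
    unfolding bertrand_type_def by blast
  from mate_conditions[OF assms this]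
  show "\<exists>l e :: real \<Rightarrow> real. smooth_on I (\<lambda>s. (l s, e s)) \<and>
      (\<forall>s\<in>I. e s \<noteq> 0 \<and>
         speed I \<gamma> s + nth_deriv I 1 l s - e s * speed I \<gamma> s * curvature I \<gamma> s = 0 \<and>
         l s * speed I \<gamma> s * curvature I \<gamma> s + nth_deriv I 1 e s = 0)"
    by blast
next
  assume \<tau>: "\<forall>s\<in>I. torsion I \<gamma> s \<noteq> 0" and "\<exists>l e :: real \<Rightarrow> real. smooth_on I (\<lambda>s. (l s, e s)) \<and>
      (\<forall>s\<in>I. e s \<noteq> 0 \<and>
         speed I \<gamma> s + nth_deriv I 1 l s - e s * speed I \<gamma> s * curvature I \<gamma> s = 0 \<and>
         l s * speed I \<gamma> s * curvature I \<gamma> s + nth_deriv I 1 e s = 0)"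
  then obtain l e where le: "smooth_on I (\<lambda>s. (l s, e s))"
    "\<And>s. s \<in> I \<Longrightarrow> e s \<noteq> 0 \<and>
         speed I \<gamma> s + nth_deriv I 1 l s - e s * speed I \<gamma> s * curvature I \<gamma> s = 0 \<and>
         l s * speed I \<gamma> s * curvature I \<gamma> s + nth_deriv I 1 e s = 0"
    by blast
  show "bertrand_type I Tangent Normal Tangent \<gamma>"
    using bertrand_type_if_conditions[OF assms bspec[OF \<tau>] le] .
next
  assume "\<exists>s\<in>I. torsion I \<gamma> s = 0"
  then obtain s where s: "s \<in> I" "torsion I \<gamma> s = 0" by blast
  show "\<not> bertrand_type I Tangent Normal Tangent \<gamma>"
  proof
    assume "bertrand_type I Tangent Normal Tangent \<gamma>"
    then obtain c where "mates I Tangent Normal Tangent \<gamma> c"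
      unfolding bertrand_type_def by blast
    from mate_conditions[OF assms this] have "torsion I \<gamma> s \<noteq> 0" using s(1) by blast
    with s show False by blast
  qed
qed

end
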